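(* Let $f,g:\mathbb{R}^n\to\mathbb{R}$ be convex and differentiable, $F=f+g$, and assume $\nabla f$ and $\nabla g$ are Lipschitz continuous with Lipschitz constants $L(f)>0$ and $L(g)>0$, respectively. Let $x^*$ be an optimal solution of $\min_{x\in\mathbb{R}^n}F(x)$. If $0<\mu\le\min\{1/L(f),1/L(g)\}$, then the iterates of the algorithm ALM (described in the context) satisfy $$F(y^k)-F(x^* )\le\frac{\|x^0-x^*\|^2}{4\mu k}\qquad\text{for all }k\ge1.$$ Thus the sequence $\{F(y^k)\}$ converges to $F(x^* )$. Moreover, if $1/(\beta\max\{L(f),L(g)\})\le\mu\le1/\max\{L(f),L(g)\}$ for some $\beta\ge1$, then for every $\epsilon>0$ the number of iterations needed to get an $\epsilon$-optimal solution is at most $\lceil C/\epsilon\rceil$, where $C=\beta\max\{L(f),L(g)\}\|x^0-x^*\|^2/4$; that is, $F(y^k)-F(x^* )\le\epsilon$ for every $k\ge1$ with $k\ge\lceil C/\epsilon\rceil$.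
   Context: $\|\cdot\|$ is the Euclidean norm. For $\mu>0$ define $$Q_f(u,v):=g(u)+f(v)+\langle\nabla f(v),u-v\rangle+\tfrac{1}{2\mu}\|u-v\|^2,$$ $$Q_g(u,v):=f(u)+g(v)+\langle\nabla g(v),u-v\rangle+\tfrac{1}{2\mu}\|u-v\|^2.$$ A point $x_\epsilon$ is $\epsilon$-optimal if $F(x_\epsilon)-F(x^* )\le\epsilon$. Algorithm ALM (alternating linearization method). Choose $\mu>0$ and $x^0=y^0\in\mathbb{R}^n$. For $k=0,1,2,\dots$: $x^{k+1}:=\arg\min_x Q_g(x,y^k)$; $y^{k+1}:=\arg\min_y Q_f(y,x^{k+1})$. *)

theory Defs
  imports "HOL-Analysis.Analysis"
begin

text \<open>The gradient is unique where it exists, and it exists wherever a function on a Euclidean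
  space is differentiable; elsewhere the value below is unspecified.\<close>

definition grad :: "('a::real_inner \<Rightarrow> real) \<Rightarrow> 'a \<Rightarrow> 'a" where
  "grad f v = (THE D. GDERIV f v :> D)"

definition Q_f :: "real \<Rightarrow> ('a::real_inner \<Rightarrow> real) \<Rightarrow> ('a \<Rightarrow> real) \<Rightarrow> 'a \<Rightarrow> 'a \<Rightarrow> real" where
  "Q_f \<mu> f g u v = g u + f v + inner (grad f v) (u - v) + 1 / (2 * \<mu>) * (norm (u - v))\<^sup>2"

definition Q_g :: "real \<Rightarrow> ('a::real_inner \<Rightarrow> real) \<Rightarrow> ('a \<Rightarrow> real) \<Rightarrow> 'a \<Rightarrow> 'a \<Rightarrow> real" where
  "Q_g \<mu> f g u v = f u + g v + inner (grad g v) (u - v) + 1 / (2 * \<mu>) * (norm (u - v))\<^sup>2"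

text \<open>The sequences \<open>x\<close> and \<open>y\<close> form a run of the alternating linearization method. Each argmin
  is rendered relationally: the next iterate is a global minimizer of the subproblem.\<close>

definition ALM_iterates ::
  "real \<Rightarrow> ('a::real_inner \<Rightarrow> real) \<Rightarrow> ('a \<Rightarrow> real) \<Rightarrow> (nat \<Rightarrow> 'a) \<Rightarrow> (nat \<Rightarrow> 'a) \<Rightarrow> bool" where
  "ALM_iterates \<mu> f g x y \<longleftrightarrow>
     x 0 = y 0 \<and>
     (\<forall>k. is_arg_min (\<lambda>u. Q_g \<mu> f g u (y k)) (\<lambda>_. True) (x (Suc k)) \<and>
          is_arg_min (\<lambda>u. Q_f \<mu> f g u (x (Suc k))) (\<lambda>_. True) (y (Suc k)))"

text \<open>Here \<open>xstar\<close> is meant to be a minimizer of \<open>F\<close>.\<close>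

definition eps_optimal :: "('a \<Rightarrow> real) \<Rightarrow> 'a \<Rightarrow> real \<Rightarrow> 'a \<Rightarrow> bool" where
  "eps_optimal F xstar \<epsilon> z \<longleftrightarrow> F z - F xstar \<le> \<epsilon>"

end

theory Submission
  imports Defs
begin

text \<open>Half a step of the method is a proximal gradient step: minimizing
  \<open>f u + g v + \<langle>\<nabla>g v, u - v\<rangle> + |u - v|\<^sup>2 / (2\<mu>)\<close> over \<open>u\<close>
  yields \<open>p\<close> with \<open>\<nabla>f p + \<nabla>g v = (v - p) / \<mu>\<close>. Bounding \<open>f\<close> from below by its
  tangent at \<open>p\<close> and \<open>g\<close> by its tangent at \<open>v\<close>, and \<open>g p\<close> from above by the quadratic model at \<open>v\<close>,
  gives \<open>|p - u|\<^sup>2 - |v - u|\<^sup>2 \<le> 2 \<mu> (F u - F p)\<close> for every \<open>u\<close>. With \<open>u = v\<close> this shows that \<open>F\<close>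
  decreases along the half steps; with \<open>u = xstar\<close> it telescopes over the \<open>2 k\<close> half steps leading
  to \<open>y k\<close>, which is where the factor \<open>4\<close> comes from.\<close>

text \<open>The derivative is linear, so its values on the basis determine a representing vector
  \<open>D\<close>. As \<open>grad\<close> is a definite description, uniqueness of \<open>D\<close>
  has to be shown as well.\<close>

lemma GDERIV_grad:
  fixes f :: "'a::euclidean_space \<Rightarrow> real"
  assumes "f differentiable (at v)"
  shows "GDERIV f v :> grad f v"
proof -
  obtain f' where f': "(f has_derivative f') (at v)"
    using assms unfolding differentiable_def by blast
  define D where "D = (\<Sum>b\<in>Basis. f' b *\<^sub>R b)"
  have "f' h = inner h D" for h
  proof -
    interpret f': linear f'
      using f' has_derivative_linear by blast
    have "f' h = f' (\<Sum>b\<in>Basis. inner h b *\<^sub>R b)"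
      by (simp add: euclidean_representation)
    also have "\<dots> = inner h D"
      by (simp add: D_def f'.sum f'.scale inner_sum_right mult.commute)
    finally show ?thesis .
  qed
  then have "f' = (\<lambda>h. inner h D)"
    by blast
  then have D: "GDERIV f v :> D"
    using f' by (simp add: gderiv_def)
  have "E = D" if "GDERIV f v :> E" for E
  proof -
    have "(\<lambda>h. inner h E) = (\<lambda>h. inner h D)"
      using that D unfolding gderiv_def by (rule has_derivative_unique)
    then have "inner (E - D) E = inner (E - D) D"
      by metis
    then have "inner (E - D) (E - D) = 0"
      by (simp add: inner_diff_right)
    then show ?thesis
      by simp
  qed
  then show ?thesis
    unfolding grad_def using D by (metis theI)
qed

lemma GDERIV_along_line:
  assumes "GDERIV f (v + t *\<^sub>R d) :> D"
  shows "((\<lambda>t. f (v + t *\<^sub>R d)) has_real_derivative inner d D) (at t)"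
proof -
  have "((\<lambda>t. v + t *\<^sub>R d) has_derivative (\<lambda>h. h *\<^sub>R d)) (at t)"
    by (auto intro!: derivative_eq_intros)
  from has_derivative_compose[OF this assms[unfolded gderiv_def]]
  show ?thesis
    by (simp add: has_field_derivative_def mult.commute[of _ "inner d D"])
qed

text \<open>Restriction to the line through \<open>p\<close> and \<open>u\<close> reduces this to
  the tangent inequality for convex functions of one real variable.\<close>

lemma convex_on_above_tangent:
  assumes "convex_on UNIV f" and D: "GDERIV f p :> D"
  shows "f p + inner D (u - p) \<le> f u"
proof -
  define \<phi> where "\<phi> t = f (p + t *\<^sub>R (u - p))" for t :: real
  have "convex_on UNIV \<phi>"
  proof (rule convex_onI)
    fix t a b :: real
    assume t: "0 < t" "t < 1"
    have "p + ((1 - t) *\<^sub>R a + t *\<^sub>R b) *\<^sub>R (u - p)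
        = (1 - t) *\<^sub>R (p + a *\<^sub>R (u - p)) + t *\<^sub>R (p + b *\<^sub>R (u - p))"
      by (simp add: algebra_simps)
    then show "\<phi> ((1 - t) *\<^sub>R a + t *\<^sub>R b) \<le> (1 - t) * \<phi> a + t * \<phi> b"
      unfolding \<phi>_def using convex_onD[OF assms(1)] t by simp
  qed simp
  moreover have "(\<phi> has_real_derivative inner (u - p) D) (at 0)"
    unfolding \<phi>_def by (rule GDERIV_along_line) (simp add: D)
  ultimately have "inner (u - p) D * (1 - 0) \<le> \<phi> 1 - \<phi> 0"
    by (intro convex_on_imp_above_tangent[where A = UNIV]) auto
  then show ?thesis
    by (simp add: \<phi>_def inner_commute)
qed

lemma descent_lemma:
  assumes D: "\<And>z. GDERIV g z :> G z" and lip: "L-lipschitz_on UNIV G"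
  shows "g p \<le> g v + inner (G v) (p - v) + L / 2 * (norm (p - v))\<^sup>2"
proof -
  define d where "d = p - v"
  \<comment> \<open>\<open>\<psi>\<close> is \<open>g\<close> minus its quadratic model along the
    segment from \<open>v\<close> to \<open>p\<close>, up to a constant. Cauchy-Schwarz and the
    Lipschitz bound make its derivative nonpositive on the segment.\<close>
  define \<psi> where
    "\<psi> t = g (v + t *\<^sub>R d) - t * inner d (G v) - L / 2 * t\<^sup>2 * (norm d)\<^sup>2" for t :: real
  have "\<psi> 1 \<le> \<psi> 0"
  proof (rule DERIV_nonpos_imp_nonincreasing[where f = \<psi>])
    fix t :: real
    assume t: "0 \<le> t" "t \<le> 1"
    have "(\<psi> has_real_derivative
        inner d (G (v + t *\<^sub>R d)) - inner d (G v) - L * t * (norm d)\<^sup>2) (at t)"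
      unfolding \<psi>_def
      by (auto intro!: derivative_eq_intros GDERIV_along_line[OF D])
    moreover have "inner d (G (v + t *\<^sub>R d) - G v) \<le> L * t * (norm d)\<^sup>2"
    proof -
      have "inner d (G (v + t *\<^sub>R d) - G v) \<le> norm d * norm (G (v + t *\<^sub>R d) - G v)"
        by (rule norm_cauchy_schwarz)
      also have "\<dots> \<le> norm d * (L * (t * norm d))"
        using lipschitz_onD[OF lip, of "v + t *\<^sub>R d" v] t
        by (intro mult_left_mono) (auto simp: dist_norm)
      finally show ?thesis
        by (simp add: power2_eq_square mult_ac)
    qed
    ultimately show "\<exists>y. (\<psi> has_real_derivative y) (at t) \<and> y \<le> 0"
      by (auto simp: inner_diff_right)
  qed simp
  then show ?thesis
    by (simp add: \<psi>_def d_def inner_commute)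
qed

text \<open>By this symmetry the results on \<open>Q_g\<close> serve both half steps, with
  \<open>f\<close> and \<open>g\<close> exchanged for the second one.\<close>

lemma Q_f_eq_Q_g: "Q_f \<mu> f g = Q_g \<mu> g f"
  by (simp add: fun_eq_iff Q_f_def Q_g_def)

lemma Q_g_minimizer_optimality:
  assumes "GDERIV f p :> D" and "\<mu> > 0"
    and min: "is_arg_min (\<lambda>u. Q_g \<mu> f g u v) (\<lambda>_. True) p"
  shows "D + grad g v = (1 / \<mu>) *\<^sub>R (v - p)"
proof -
  \<comment> \<open>\<open>E\<close> is the gradient of the subproblem's objective at
    \<open>p\<close>, so it vanishes at a minimizer.\<close>
  define E where "E = D + grad g v - (1 / \<mu>) *\<^sub>R (v - p)"
  have *: "(f has_derivative (\<lambda>h. inner h D)) (at p)"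
    using assms(1) by (simp add: gderiv_def)
  \<comment> \<open>Writing the squared norm as an inner product lets the product rule apply even if
    \<open>p = v\<close>, where the norm itself is not differentiable.\<close>
  have "((\<lambda>u. f u + g v + inner (grad g v) (u - v) + 1 / (2 * \<mu>) * inner (u - v) (u - v))
      has_derivative (\<lambda>h. inner h E)) (at p)"
    using \<open>\<mu> > 0\<close>
    by (auto intro!: derivative_eq_intros *
        simp: fun_eq_iff E_def inner_simps inner_commute field_simps)
  then have "((\<lambda>u. Q_g \<mu> f g u v) has_derivative (\<lambda>h. inner h E)) (at p)"
    by (simp add: Q_g_def power2_norm_eq_inner)
  moreover have "\<forall>\<^sub>F u in at p. Q_g \<mu> f g p v \<le> Q_g \<mu> f g u v"
    using min by (intro always_eventually) (auto simp: is_arg_min_def not_less)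
  ultimately have "(\<lambda>h. inner h E) = (\<lambda>h. 0)"
    by (rule has_derivative_local_min)
  then have "inner E E = 0"
    by metis
  then show ?thesis
    by (simp add: E_def)
qed

lemma half_step:
  fixes f g :: "'a::euclidean_space \<Rightarrow> real"
  assumes convex: "convex_on UNIV f" "convex_on UNIV g"
    and diff: "f differentiable_on UNIV" "g differentiable_on UNIV"
    and lip: "L-lipschitz_on UNIV (grad g)" and \<mu>: "\<mu> > 0" "L \<le> 1 / \<mu>"
    and min: "is_arg_min (\<lambda>u. Q_g \<mu> f g u v) (\<lambda>_. True) p"
  shows "(norm (p - u))\<^sup>2 - (norm (v - u))\<^sup>2 \<le> 2 * \<mu> * ((f u + g u) - (f p + g p))"
proof -
  have f: "GDERIV f z :> grad f z" and g: "GDERIV g z :> grad g z" for z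
    using diff by (auto simp: differentiable_on_def intro: GDERIV_grad)
  \<comment> \<open>The step size restriction enters here: it replaces \<open>L\<close> by
    \<open>1 / \<mu>\<close>, the curvature used in \<open>Q_g\<close>.\<close>
  have "L / 2 * (norm (p - v))\<^sup>2 \<le> (1 / \<mu>) / 2 * (norm (p - v))\<^sup>2"
    using \<mu> by (intro mult_right_mono divide_right_mono) auto
  then have "g p \<le> g v + inner (grad g v) (p - v) + 1 / \<mu> / 2 * (norm (p - v))\<^sup>2"
    using descent_lemma[OF g lip, of p v] by linarith
  moreover have "f p + inner (grad f p) (u - p) \<le> f u"
    by (rule convex_on_above_tangent[OF convex(1) f])
  moreover have "g v + inner (grad g v) (u - v) \<le> g u"
    by (rule convex_on_above_tangent[OF convex(2) g])
  \<comment> \<open>The part along \<open>u - p\<close> joins \<open>grad f p\<close> in the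
    optimality condition; the part along \<open>p - v\<close> cancels against the upper bound on
    \<open>g p\<close>.\<close>
  moreover have "inner (grad g v) (u - v) = inner (grad g v) (u - p) + inner (grad g v) (p - v)"
    by (simp add: inner_diff_right)
  moreover have "inner (grad f p) (u - p) + inner (grad g v) (u - p)
      = 1 / \<mu> * inner (v - p) (u - p)"
    using Q_g_minimizer_optimality[OF f \<mu>(1) min] by (metis inner_add_left inner_scaleR_left)
  ultimately have "1 / \<mu> * inner (v - p) (u - p) - 1 / \<mu> / 2 * (norm (p - v))\<^sup>2
      \<le> (f u + g u) - (f p + g p)"
    by linarith
  from mult_left_mono[OF this, of "2 * \<mu>"]
  have "2 * inner (v - p) (u - p) - (norm (p - v))\<^sup>2 \<le> 2 * \<mu> * ((f u + g u) - (f p + g p))"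
    using \<mu>(1) by (simp add: right_diff_distrib)
  \<comment> \<open>The left-hand side just obtained equals
    \<open>(norm (p - u))\<^sup>2 - (norm (v - u))\<^sup>2\<close>, by expanding
    \<open>v - u\<close> as \<open>(v - p) + (p - u)\<close>.\<close>
  then show ?thesis
    by (simp add: power2_norm_eq_inner inner_simps inner_commute)
qed

text \<open>Keeping the squared distance of \<open>y k\<close> to \<open>u\<close> makes the
  induction work: the next two half steps are paid for by its change.\<close>

lemma ALM_sum_bound:
  fixes F :: "'a::real_normed_vector \<Rightarrow> real"
  assumes \<mu>: "\<mu> > 0"
    and x: "\<And>k u. (norm (x (Suc k) - u))\<^sup>2 - (norm (y k - u))\<^sup>2 \<le> 2 * \<mu> * (F u - F (x (Suc k)))"
    and y: "\<And>k u. (norm (y (Suc k) - u))\<^sup>2 - (norm (x (Suc k) - u))\<^sup>2 \<le> 2 * \<mu> * (F u - F (y (Suc k)))"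
  shows "4 * \<mu> * real k * (F (y k) - F u) + (norm (y k - u))\<^sup>2 \<le> (norm (y 0 - u))\<^sup>2"
proof (induction k)
  case 0
  show ?case by simp
next
  case (Suc k)
  have "0 \<le> 2 * \<mu> * (F (y k) - F (x (Suc k)))" "0 \<le> 2 * \<mu> * (F (x (Suc k)) - F (y (Suc k)))"
    using x[of k "y k"] y[of k "x (Suc k)"] by (simp_all add: order_trans[OF zero_le_power2])
  then have mono: "F (x (Suc k)) \<le> F (y k)" "F (y (Suc k)) \<le> F (x (Suc k))"
    using \<mu> by (auto simp: zero_le_mult_iff)
  \<comment> \<open>Monotonicity allows the gaps at earlier iterates to be replaced by the newest
    one, so that both half steps contribute \<open>2 * \<mu>\<close> times the same gap.\<close>
  have "4 * \<mu> * real k * (F (y (Suc k)) - F u) \<le> 4 * \<mu> * real k * (F (y k) - F u)"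
    using mono \<mu> by (intro mult_left_mono) auto
  moreover have "2 * \<mu> * (F (y (Suc k)) - F u) \<le> 2 * \<mu> * (F (x (Suc k)) - F u)"
    using mono \<mu> by (intro mult_left_mono) auto
  ultimately show ?case
    using Suc.IH x[of k u] y[of k u] by (simp add: algebra_simps)
qed

theorem corollary2p4:
  fixes f g F :: "real ^ 'n \<Rightarrow> real"
    and Lf Lg \<mu> :: real
    and xstar :: "real ^ 'n"
    and x y :: "nat \<Rightarrow> real ^ 'n"
  assumes f_convex: "convex_on UNIV f" and g_convex: "convex_on UNIV g"
    and f_diff: "f differentiable_on UNIV" and g_diff: "g differentiable_on UNIV"
    and F_eq: "\<And>z. F z = f z + g z"
    and Lf_pos: "Lf > 0" and Lg_pos: "Lg > 0"
    and f_lip: "Lf-lipschitz_on UNIV (grad f)"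
    and g_lip: "Lg-lipschitz_on UNIV (grad g)"
    and xstar: "is_arg_min F (\<lambda>_. True) xstar"
    and mu_pos: "0 < \<mu>" and mu_le: "\<mu> \<le> min (1 / Lf) (1 / Lg)"
    and alm: "ALM_iterates \<mu> f g x y"
  shows "(\<forall>k\<ge>1. F (y k) - F xstar \<le> (norm (x 0 - xstar))\<^sup>2 / (4 * \<mu> * real k))
    \<and> (\<lambda>k. F (y k)) \<longlonglongrightarrow> F xstar
    \<and> (\<forall>\<beta>::real. \<beta> \<ge> 1 \<longrightarrow> 1 / (\<beta> * max Lf Lg) \<le> \<mu> \<longrightarrow> \<mu> \<le> 1 / max Lf Lg \<longrightarrow>
         (\<forall>\<epsilon>>0. \<forall>k\<ge>1.
            int k \<ge> \<lceil>(\<beta> * max Lf Lg * (norm (x 0 - xstar))\<^sup>2 / 4) / \<epsilon>\<rceil> \<longrightarrow>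
            eps_optimal F xstar \<epsilon> (y k)))"
proof (intro conjI allI impI)
  have "Lf \<le> 1 / \<mu>" "Lg \<le> 1 / \<mu>"
    using mu_le mu_pos Lf_pos Lg_pos by (simp_all add: field_simps)
  note step = mu_pos this
  have min_x: "is_arg_min (\<lambda>u. Q_g \<mu> f g u (y k)) (\<lambda>_. True) (x (Suc k))"
    and min_y: "is_arg_min (\<lambda>u. Q_g \<mu> g f u (x (Suc k))) (\<lambda>_. True) (y (Suc k))" for k
    using alm by (auto simp: ALM_iterates_def Q_f_eq_Q_g)
  have half_x: "(norm (x (Suc k) - u))\<^sup>2 - (norm (y k - u))\<^sup>2 \<le> 2 * \<mu> * (F u - F (x (Suc k)))" for k u
    using half_step[OF f_convex g_convex f_diff g_diff g_lip step(1,3) min_x] by (simp add: F_eq)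
  have half_y: "(norm (y (Suc k) - u))\<^sup>2 - (norm (x (Suc k) - u))\<^sup>2 \<le> 2 * \<mu> * (F u - F (y (Suc k)))" for k u
    using half_step[OF g_convex f_convex g_diff f_diff f_lip step(1,2) min_y]
    by (simp add: F_eq add.commute)
  define N where "N = (norm (x 0 - xstar))\<^sup>2"
  have N: "N \<ge> 0" "(norm (y 0 - xstar))\<^sup>2 = N"
    using alm by (auto simp: N_def ALM_iterates_def)
  have rate: "F (y k) - F xstar \<le> N / (4 * \<mu> * real k)" if "k \<ge> 1" for k
  proof -
    have "4 * \<mu> * real k * (F (y k) - F xstar) \<le> N"
      using ALM_sum_bound[where F = F and x = x and y = y and k = k and u = xstar, OF mu_pos half_x half_y] N
        zero_le_power2[of "norm (y k - xstar)"] by linarith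
    then show ?thesis
      using that mu_pos by (simp add: pos_le_divide_eq mult.commute)
  qed
  then show "F (y k) - F xstar \<le> (norm (x 0 - xstar))\<^sup>2 / (4 * \<mu> * real k)" if "1 \<le> k" for k
    using that by (simp add: N_def)
  have opt: "F xstar \<le> F z" for z
    using xstar by (simp add: is_arg_min_def not_less)
  have "(\<lambda>k. N / (4 * \<mu>) / real k) \<longlonglongrightarrow> 0"
    by (rule lim_const_over_n)
  then have "(\<lambda>k. F (y k) - F xstar) \<longlonglongrightarrow> 0"
  proof (rule Lim_null_comparison[rotated])
    show "\<forall>\<^sub>F k in sequentially. norm (F (y k) - F xstar) \<le> N / (4 * \<mu>) / real k"
      \<comment> \<open>Optimality of \<open>xstar\<close> removes the absolute value. The
        comparison starts at \<open>1\<close>, since at \<open>k = 0\<close> the bound is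
        \<open>0\<close> by the convention for division by zero.\<close>
      using rate opt by (intro eventually_sequentiallyI[of 1]) simp
  qed
  then show "(\<lambda>k. F (y k)) \<longlonglongrightarrow> F xstar"
    by (simp add: LIM_zero_iff)
  fix \<beta> \<epsilon> :: real and k :: nat
  assume "\<beta> \<ge> 1" and beta: "1 / (\<beta> * max Lf Lg) \<le> \<mu>" and "\<epsilon> > 0" and "k \<ge> 1"
    and k: "int k \<ge> \<lceil>(\<beta> * max Lf Lg * (norm (x 0 - xstar))\<^sup>2 / 4) / \<epsilon>\<rceil>"
  \<comment> \<open>The lower bound on \<open>\<mu>\<close> says \<open>1 / \<mu> \<le> M\<close>.
    So the rate is at most \<open>M * N / (4 * real k)\<close>, which is at most
    \<open>\<epsilon>\<close> once \<open>k\<close> reaches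
    \<open>M * N / (4 * \<epsilon>)\<close>.\<close>
  define M where "M = \<beta> * max Lf Lg"
  have "M > 0"
    using \<open>\<beta> \<ge> 1\<close> Lf_pos by (simp add: M_def)
  have "M * N / 4 / \<epsilon> \<le> real k"
    using k by (simp add: M_def N_def ceiling_le_iff)
  then have "M * N \<le> 4 * real k * \<epsilon>"
    using \<open>\<epsilon> > 0\<close> by (simp add: field_simps)
  moreover have "1 / \<mu> \<le> M"
    using beta \<open>M > 0\<close> mu_pos by (simp add: M_def[symmetric] field_simps)
  then have "1 / \<mu> * N \<le> M * N"
    using N(1) by (rule mult_right_mono)
  ultimately have "1 / \<mu> * N \<le> 4 * real k * \<epsilon>"
    by linarith
  then have "N / (4 * \<mu> * real k) \<le> \<epsilon>"
    using mu_pos \<open>k \<ge> 1\<close> by (simp add: field_simps)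
  then show "eps_optimal F xstar \<epsilon> (y k)"
    using rate[OF \<open>k \<ge> 1\<close>] by (simp add: eps_optimal_def)
qed

end
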